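(* Let $X$ be a compact metric space, let $x_0\neq y_0$ be points of $X$ (the starting points of the lion and of the man respectively), and let $T>0$. Then in the bounded-time lion and man game on $X$ with time bound $T$, at least one of the lion and the man has a winning strategy.
   Context: Bounded-time lion and man game on a metric space $X$ with starting points $x_0$ (lion) and $y_0$ (man), $x_0\ne y_0$, and time bound $T>0$. A lion path is a function $l:[0,T]\to X$ with $d(l(s),l(t))\le |s-t|$ for all $s,t$ and $l(0)=x_0$; a man path is a function $m:[0,T]\to X$ with $d(m(s),m(t))\le|s-t|$ for all $s,t$ and $m(0)=y_0$. Let $L$ be the set of lion paths and $M$ the set of man paths. A lion strategy is a function $G:M\to L$ satisfying the no-lookahead rule: if $m,m'\in M$ agree on $[0,t]$ then $G(m)$ and $G(m')$ agree on $[0,t]$. A man strategy is a function $F:L\to M$ such that if $l,l'\in L$ agree on $[0,t]$ then $F(l)$ and $F(l')$ agree on $[0,t]$. A lion strategy $G$ is winning if for every $m\in M$ there is $t\in[0,T]$ with $G(m)(t)=m(t)$. A man strategy $F$ is winning if for every $l\in L$ and every $t\in[0,T]$ we have $F(l)(t)\neq l(t)$. *)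

theory Defs
  imports "HOL-Analysis.Analysis"
begin

(* Extensionality makes a path exactly a function on {0..T}: two paths are equal as HOL functions
   iff they agree on {0..T}. *)
definition paths :: "'a::metric_space set \<Rightarrow> real \<Rightarrow> 'a \<Rightarrow> (real \<Rightarrow> 'a) set" where
  "paths X T p = {f \<in> {0..T} \<rightarrow>\<^sub>E X.
     (\<forall>s\<in>{0..T}. \<forall>t\<in>{0..T}. dist (f s) (f t) \<le> \<bar>s - t\<bar>) \<and> f 0 = p}"

(* A is the set of the opponent's paths, B the set of the player's own paths.
   The values of F outside A play no role. *)
definition no_lookahead_strategy ::
  "real \<Rightarrow> (real \<Rightarrow> 'a) set \<Rightarrow> (real \<Rightarrow> 'a) set \<Rightarrow> ((real \<Rightarrow> 'a) \<Rightarrow> (real \<Rightarrow> 'a)) \<Rightarrow> bool" where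
  "no_lookahead_strategy T A B F \<longleftrightarrow> F \<in> A \<rightarrow> B \<and>
     (\<forall>p\<in>A. \<forall>p'\<in>A. \<forall>t\<in>{0..T}.
        (\<forall>s\<in>{0..t}. p s = p' s) \<longrightarrow> (\<forall>s\<in>{0..t}. F p s = F p' s))"

definition lion_strategy ::
  "'a::metric_space set \<Rightarrow> real \<Rightarrow> 'a \<Rightarrow> 'a \<Rightarrow> ((real \<Rightarrow> 'a) \<Rightarrow> (real \<Rightarrow> 'a)) \<Rightarrow> bool" where
  "lion_strategy X T x0 y0 G \<longleftrightarrow> no_lookahead_strategy T (paths X T y0) (paths X T x0) G"

definition man_strategy ::
  "'a::metric_space set \<Rightarrow> real \<Rightarrow> 'a \<Rightarrow> 'a \<Rightarrow> ((real \<Rightarrow> 'a) \<Rightarrow> (real \<Rightarrow> 'a)) \<Rightarrow> bool" where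
  "man_strategy X T x0 y0 F \<longleftrightarrow> no_lookahead_strategy T (paths X T x0) (paths X T y0) F"

definition lion_winning_strategy ::
  "'a::metric_space set \<Rightarrow> real \<Rightarrow> 'a \<Rightarrow> 'a \<Rightarrow> ((real \<Rightarrow> 'a) \<Rightarrow> (real \<Rightarrow> 'a)) \<Rightarrow> bool" where
  "lion_winning_strategy X T x0 y0 G \<longleftrightarrow> lion_strategy X T x0 y0 G \<and>
     (\<forall>m\<in>paths X T y0. \<exists>t\<in>{0..T}. G m t = m t)"

definition man_winning_strategy ::
  "'a::metric_space set \<Rightarrow> real \<Rightarrow> 'a \<Rightarrow> 'a \<Rightarrow> ((real \<Rightarrow> 'a) \<Rightarrow> (real \<Rightarrow> 'a)) \<Rightarrow> bool" where
  "man_winning_strategy X T x0 y0 F \<longleftrightarrow> man_strategy X T x0 y0 F \<and>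
     (\<forall>l\<in>paths X T x0. \<forall>t\<in>{0..T}. F l t \<noteq> l t)"

end

theory Submission
  imports Defs
begin

text \<open>
  Cut \<open>[0,T]\<close> into \<open>n\<close> equal steps and let the players alternate, the man announcing his path on
  each step before the lion does.  This game has finitely many rounds, so it is determined: from a
  position where the lion cannot force a capture, the man has a move after which the lion still
  cannot, whatever he replies.  No topology is involved here.

  If the man can stay free for some \<open>n\<close>, then he has won the original game as well: he fixes his
  path on a step knowing the lion's path only up to the beginning of that step, so his strategy
  obeys the no-lookahead rule (\<open>man_wins_if_discrete_escape\<close>).

  Otherwise the lion forces a capture for every \<open>n\<close>, with a response \<open>G n\<close> that looks ahead by at most
  \<open>T / n\<close> (\<open>lion_reply_if_discrete_capture\<close>).  By Tychonoff's theorem the responses \<open>G n\<close> cluster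
  pointwise to some \<open>G\<close>.  Since all paths are 1-Lipschitz, the lookahead \<open>T / n\<close> costs an error of
  at most \<open>2 * T / n\<close> in position, which vanishes in the limit, and capture survives the limit because
  the capture times cluster in the compact interval \<open>[0,T]\<close>
  (\<open>lion_wins_if_vanishing_lookahead\<close>).
\<close>

section \<open>Paths\<close>

definition agree_upto :: "real \<Rightarrow> (real \<Rightarrow> 'a) \<Rightarrow> (real \<Rightarrow> 'a) \<Rightarrow> bool" where
  "agree_upto t p q \<longleftrightarrow> (\<forall>s\<in>{0..t}. p s = q s)"

lemma agree_upto_refl [simp]: "agree_upto t p p"
  by (simp add: agree_upto_def)

lemma agree_upto_sym: "agree_upto t p q \<Longrightarrow> agree_upto t q p"
  by (simp add: agree_upto_def)

lemma agree_upto_trans: "agree_upto t p q \<Longrightarrow> agree_upto t q r \<Longrightarrow> agree_upto t p r"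
  by (simp add: agree_upto_def)

lemma agree_upto_mono: "agree_upto t p q \<Longrightarrow> s \<le> t \<Longrightarrow> agree_upto s p q"
  by (simp add: agree_upto_def)

lemma paths_dist_le:
  "p \<in> paths X T x \<Longrightarrow> s \<in> {0..T} \<Longrightarrow> t \<in> {0..T} \<Longrightarrow> dist (p s) (p t) \<le> \<bar>s - t\<bar>"
  by (auto simp: paths_def)

lemma paths_in: "p \<in> paths X T x \<Longrightarrow> t \<in> {0..T} \<Longrightarrow> p t \<in> X"
  by (auto simp: paths_def)

lemma paths_start: "p \<in> paths X T x \<Longrightarrow> p 0 = x"
  by (simp add: paths_def)

lemma paths_agree_upto_0: "p \<in> paths X T x \<Longrightarrow> q \<in> paths X T x \<Longrightarrow> agree_upto 0 p q"
  by (simp add: agree_upto_def paths_start)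

lemma const_path_in_paths: "x \<in> X \<Longrightarrow> 0 \<le> T \<Longrightarrow> restrict (\<lambda>_. x) {0..T} \<in> paths X T x"
  by (auto simp: paths_def)

section \<open>Strategies assembled round by round\<close>

text \<open>
  Read \<open>Q k p q\<close> as: after \<open>k\<close> rounds the player's own path \<open>q\<close> is in good order against the
  opponent's path \<open>p\<close>.  His moves can be picked as a function of what he has seen, and not of the
  opponent's whole path: the set of good moves that lead to \<open>Q (Suc k)\<close> depends only on \<open>p\<close> up to
  time \<open>g (Suc k)\<close>, and Hilbert choice picks the same element from equal sets.  Separate times
  \<open>g k\<close> (seen) and \<open>h k\<close> (committed) let one lemma serve both the player who moves first in a round
  and the one who moves second.
\<close>

lemma round_by_round_strategy:
  fixes h g :: "nat \<Rightarrow> real" and A B :: "(real \<Rightarrow> 'a) set"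
  assumes mono: "mono h" "mono g" and q0: "q0 \<in> B"
    and start: "\<And>p. p \<in> A \<Longrightarrow> Q 0 p q0"
    and step: "\<And>k p q. \<lbrakk>k < n; p \<in> A; q \<in> B; Q k p q\<rbrakk> \<Longrightarrow>
                 \<exists>q'\<in>B. agree_upto (h k) q q' \<and> Q (Suc k) p q'"
    and local: "\<And>k p p' q. \<lbrakk>k \<le> n; agree_upto (g k) p p'; Q k p q\<rbrakk> \<Longrightarrow> Q k p' q"
  shows "\<exists>F\<in>A \<rightarrow> B. (\<forall>p\<in>A. Q n p (F p)) \<and>
    (\<forall>k\<le>n. \<forall>p\<in>A. \<forall>p'\<in>A. agree_upto (g k) p p' \<longrightarrow> agree_upto (h k) (F p) (F p'))"
proof -
  define move where
    "move = (\<lambda>k p q. SOME q'. q' \<in> B \<and> agree_upto (h k) q q' \<and> Q (Suc k) p q')"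
  define play where "play = (\<lambda>p. rec_nat q0 (\<lambda>k. move k p))"
  have play_Suc: "play p (Suc k) = move k p (play p k)" for p k
    by (simp add: play_def)
  have move: "move k p q \<in> B \<and> agree_upto (h k) q (move k p q) \<and> Q (Suc k) p (move k p q)"
    if "k < n" "p \<in> A" "q \<in> B" "Q k p q" for k p q
  proof -
    have "\<exists>q'. q' \<in> B \<and> agree_upto (h k) q q' \<and> Q (Suc k) p q'"
      using step[OF that] by blast
    then show ?thesis unfolding move_def by (rule someI_ex)
  qed
  have good: "play p k \<in> B \<and> Q k p (play p k)" if "k \<le> n" "p \<in> A" for k p
    using that
  proof (induction k)
    case 0
    then show ?case by (simp add: play_def q0 start)
  next
    case (Suc k)
    then show ?case using move[of k p "play p k"] by (simp add: play_Suc)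
  qed
  have settled: "agree_upto (h k) (play p k) (play p n)" if "k \<le> n" "p \<in> A" for k p
    using that
  proof (induction rule: inc_induct)
    case base
    then show ?case by simp
  next
    case (step j)
    have "agree_upto (h j) (play p j) (play p (Suc j))"
      using move[of j p "play p j"] good[of j p] step by (simp add: play_Suc)
    moreover have "agree_upto (h j) (play p (Suc j)) (play p n)"
      using step monoD[OF \<open>mono h\<close>, of j "Suc j"] by (auto intro: agree_upto_mono)
    ultimately show ?case by (rule agree_upto_trans)
  qed
  have same: "play p k = play p' k" if "k \<le> n" "agree_upto (g k) p p'" for k p p'
    using that
  proof (induction k)
    case 0
    then show ?case by (simp add: play_def)
  next
    case (Suc k)
    have "agree_upto (g k) p p'"
      using Suc.prems monoD[OF \<open>mono g\<close>, of k "Suc k"] by (auto intro: agree_upto_mono)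
    then have "play p k = play p' k" using Suc by simp
    moreover have "Q (Suc k) p = Q (Suc k) p'"
      using local[OF Suc.prems(1)] Suc.prems(2) agree_upto_sym by blast
    ultimately show ?case by (simp add: play_Suc move_def)
  qed
  show ?thesis
  proof (intro bexI[of _ "\<lambda>p. play p n"] conjI ballI allI impI)
    show "(\<lambda>p. play p n) \<in> A \<rightarrow> B" using good by simp
    show "Q n p (play p n)" if "p \<in> A" for p using good that by simp
    show "agree_upto (h k) (play p n) (play p' n)"
      if "k \<le> n" "p \<in> A" "p' \<in> A" "agree_upto (g k) p p'" for k p p'
    proof -
      have "agree_upto (h k) (play p k) (play p' n)"
        using settled[of k p'] same[of k p p'] that by simp
      then show ?thesis
        using settled[of k p] that by (blast intro: agree_upto_trans agree_upto_sym)
    qed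
  qed
qed

section \<open>The discrete game\<close>

text \<open>
  \<open>capture_from L M T h n k l m\<close> says that, when \<open>l\<close> and \<open>m\<close> have been played up to time \<open>h k\<close>, the lion
  can force a capture in the rounds \<open>k, \<dots>, n - 1\<close>, round \<open>j\<close> extending both paths from \<open>h j\<close> to
  \<open>h (Suc j)\<close>, the man first.  Moves are whole paths of which only the part up to the end of
  the round is binding; this avoids handling path segments and their concatenation.  Whether the man
  was caught is read off the two final paths.
\<close>

inductive capture_from ::
  "(real \<Rightarrow> 'a) set \<Rightarrow> (real \<Rightarrow> 'a) set \<Rightarrow> real \<Rightarrow> (nat \<Rightarrow> real) \<Rightarrow> nat \<Rightarrow>
     nat \<Rightarrow> (real \<Rightarrow> 'a) \<Rightarrow> (real \<Rightarrow> 'a) \<Rightarrow> bool"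
  for L M T h n where
  caught: "\<exists>t\<in>{0..T}. l t = m t \<Longrightarrow> capture_from L M T h n n l m"
| round: "\<lbrakk>k < n; \<And>m'. m' \<in> M \<Longrightarrow> agree_upto (h k) m m' \<Longrightarrow>
            \<exists>l'\<in>L. agree_upto (h k) l l' \<and> capture_from L M T h n (Suc k) l' m'\<rbrakk>
          \<Longrightarrow> capture_from L M T h n k l m"

lemma capture_from_end:
  "capture_from L M T h n n l m \<longleftrightarrow> (\<exists>t\<in>{0..T}. l t = m t)"
  by (subst capture_from.simps) simp

lemma capture_from_round:
  "k < n \<Longrightarrow> capture_from L M T h n k l m \<longleftrightarrow>
     (\<forall>m'\<in>M. agree_upto (h k) m m' \<longrightarrow>
        (\<exists>l'\<in>L. agree_upto (h k) l l' \<and> capture_from L M T h n (Suc k) l' m'))"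
  by (subst capture_from.simps) auto

text \<open>
  Every later move may only extend what has been played, so the rest of the paths \<open>l\<close> and \<open>m\<close> is
  irrelevant.  At the end of the game the same holds because the last grid time \<open>h n\<close> is \<open>T\<close>.
\<close>

lemma capture_from_local:
  assumes "k \<le> n" and "h n = T" and l: "agree_upto (h k) l l'" and m: "agree_upto (h k) m m'"
    and cap: "capture_from L M T h n k l m"
  shows "capture_from L M T h n k l' m'"
proof (cases "k = n")
  case True
  then show ?thesis
    using assms by (auto simp: capture_from_end agree_upto_def)
next
  case False
  with \<open>k \<le> n\<close> have "k < n" by simp
  show ?thesis
    unfolding capture_from_round[OF \<open>k < n\<close>]
  proof (intro ballI impI)
    fix m'' assume "m'' \<in> M" "agree_upto (h k) m' m''"
    then obtain l'' where "l'' \<in> L" "agree_upto (h k) l l''" "capture_from L M T h n (Suc k) l'' m''"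
      using cap m unfolding capture_from_round[OF \<open>k < n\<close>] by (blast intro: agree_upto_trans)
    then show "\<exists>l''\<in>L. agree_upto (h k) l' l'' \<and> capture_from L M T h n (Suc k) l'' m''"
      using l by (blast intro: agree_upto_trans agree_upto_sym)
  qed
qed

lemma lion_reply_if_discrete_capture:
  assumes "mono h" and "h 0 = 0" and "h n = T"
    and "l0 \<in> paths X T x0" and m0: "m0 \<in> paths X T y0"
    and cap: "capture_from (paths X T x0) (paths X T y0) T h n 0 l0 m0"
  shows "\<exists>G\<in>paths X T y0 \<rightarrow> paths X T x0. (\<forall>m\<in>paths X T y0. \<exists>t\<in>{0..T}. G m t = m t) \<and>
    (\<forall>k\<le>n. \<forall>m\<in>paths X T y0. \<forall>m'\<in>paths X T y0.
       agree_upto (h k) m m' \<longrightarrow> agree_upto (h k) (G m) (G m'))"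
proof -
  let ?L = "paths X T x0" and ?M = "paths X T y0"
  let ?Q = "\<lambda>k m l. capture_from ?L ?M T h n k l m"
  have start: "?Q 0 m l0" if "m \<in> ?M" for m
    using capture_from_local[OF _ \<open>h n = T\<close> _ _ cap] paths_agree_upto_0[OF m0 that]
    by (simp add: \<open>h 0 = 0\<close>)
  have step: "\<exists>l'\<in>?L. agree_upto (h k) l l' \<and> ?Q (Suc k) m l'"
    if "k < n" "m \<in> ?M" "l \<in> ?L" "?Q k m l" for k m l
    using that by (auto simp: capture_from_round)
  have local: "?Q k m' l" if "k \<le> n" "agree_upto (h k) m m'" "?Q k m l" for k m m' l
    using capture_from_local[OF that(1) \<open>h n = T\<close> _ that(2,3)] by simp
  show ?thesis
    using round_by_round_strategy[of h h l0 ?L ?M ?Q n,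
        OF \<open>mono h\<close> \<open>mono h\<close> \<open>l0 \<in> ?L\<close> start step local]
    by (simp only: capture_from_end)
qed

text \<open>
  The man needs his path on a round before the lion moves in it, so his good positions at time
  \<open>h k\<close> must be good against every continuation of the lion's path from the preceding grid time
  \<open>h (k - 1)\<close>.  (For \<open>k = 0\<close> both times are \<open>0\<close>.)  This delay is what makes his discrete strategy legal in continuous time.
\<close>

lemma man_wins_if_discrete_escape:
  assumes "mono h" and "h 0 = 0" and "h n = T"
    and l0: "l0 \<in> paths X T x0" and "m0 \<in> paths X T y0"
    and esc: "\<not> capture_from (paths X T x0) (paths X T y0) T h n 0 l0 m0"
  shows "\<exists>F. man_winning_strategy X T x0 y0 F"
proof -
  let ?L = "paths X T x0" and ?M = "paths X T y0"
  let ?g = "\<lambda>k. h (k - 1)"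
  let ?Q = "\<lambda>k l m. \<forall>l'\<in>?L. agree_upto (?g k) l l' \<longrightarrow> \<not> capture_from ?L ?M T h n k l' m"
  have "mono ?g" using \<open>mono h\<close> by (simp add: mono_def)
  have start: "?Q 0 l m0" if "l \<in> ?L" for l
  proof (intro ballI impI notI)
    fix l' assume "l' \<in> ?L" and cap: "capture_from ?L ?M T h n 0 l' m0"
    then have "agree_upto (h 0) l' l0"
      using paths_agree_upto_0 l0 by (simp add: \<open>h 0 = 0\<close>)
    then show False
      using capture_from_local[where k = 0, OF _ \<open>h n = T\<close> _ agree_upto_refl cap] esc by simp
  qed
  have step: "\<exists>m'\<in>?M. agree_upto (h k) m m' \<and> ?Q (Suc k) l m'"
    if "k < n" "l \<in> ?L" "m \<in> ?M" "?Q k l m" for k l m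
  proof -
    have "\<not> capture_from ?L ?M T h n k l m" using that by auto
    then show ?thesis unfolding capture_from_round[OF \<open>k < n\<close>] by auto
  qed
  have local: "?Q k l' m" if "k \<le> n" "agree_upto (?g k) l l'" "?Q k l m" for k l l' m
    using that by (blast intro: agree_upto_trans)
  have "\<exists>F\<in>?L \<rightarrow> ?M. (\<forall>l\<in>?L. ?Q n l (F l)) \<and>
    (\<forall>k\<le>n. \<forall>l\<in>?L. \<forall>l'\<in>?L. agree_upto (?g k) l l' \<longrightarrow> agree_upto (h k) (F l) (F l'))"
    by (rule round_by_round_strategy[of h ?g m0 ?M ?L ?Q n,
          OF \<open>mono h\<close> \<open>mono ?g\<close> \<open>m0 \<in> ?M\<close> start step local])
  then obtain F where F: "F \<in> ?L \<rightarrow> ?M" and safe: "\<forall>l\<in>?L. ?Q n l (F l)"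
    and causal: "\<forall>k\<le>n. \<forall>l\<in>?L. \<forall>l'\<in>?L.
                   agree_upto (?g k) l l' \<longrightarrow> agree_upto (h k) (F l) (F l')"
    by (elim bexE conjE)
  have "agree_upto t (F l) (F l')"
    if "l \<in> ?L" "l' \<in> ?L" "t \<in> {0..T}" "agree_upto t l l'" for l l' t
  proof -
    \<comment> \<open>\<open>h k\<close> is the first grid time not before \<open>t\<close>, so the lion's path up to \<open>h (k - 1)\<close> is known
      at time \<open>t\<close> and already fixes the man's path up to \<open>t\<close>.\<close>
    define k where "k = (LEAST k. t \<le> h k)"
    have "t \<le> h n" using that \<open>h n = T\<close> by simp
    then have k: "k \<le> n" "t \<le> h k"
      unfolding k_def by (auto intro: Least_le LeastI)
    have "h (k - 1) \<le> t"
    proof (cases k)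
      case 0
      then show ?thesis using \<open>h 0 = 0\<close> that by simp
    next
      case (Suc j)
      then have "\<not> t \<le> h j" unfolding k_def by (metis lessI not_less_Least)
      then show ?thesis using Suc by simp
    qed
    then have "agree_upto (?g k) l l'" using that(4) by (rule agree_upto_mono[rotated])
    then have "agree_upto (h k) (F l) (F l')" using causal k(1) that(1,2) by blast
    then show ?thesis using k(2) by (rule agree_upto_mono)
  qed
  moreover have "F l t \<noteq> l t" if "l \<in> ?L" "t \<in> {0..T}" for l t
  proof -
    have "\<not> capture_from ?L ?M T h n n l (F l)"
      using safe that(1) agree_upto_refl by blast
    then show ?thesis
      using that(2) unfolding capture_from_end by metis
  qed
  ultimately have "man_winning_strategy X T x0 y0 F"
    using F unfolding man_winning_strategy_def man_strategy_def no_lookahead_strategy_def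
      agree_upto_def[symmetric] by blast
  then show ?thesis by blast
qed

section \<open>Letting the lookahead tend to zero\<close>

text \<open>
  Compactness of an uncountable power of \<open>X\<close> does not give convergent subsequences.  A finer filter
  is enough: it plays the part of a subnet.
\<close>

lemma compact_convergent_along_finer_filter:
  assumes "compact K" and "F \<noteq> bot" and "\<And>n. f n \<in> K"
  obtains x F' where "x \<in> K" "F' \<le> F" "F' \<noteq> bot" "(f \<longlongrightarrow> x) F'"
proof -
  have "filtermap f F \<noteq> bot" "\<forall>\<^sub>F y in filtermap f F. y \<in> K"
    using assms by (simp_all add: filtermap_bot_iff eventually_filtermap)
  then obtain x where x: "x \<in> K" and cluster: "inf (nhds x) (filtermap f F) \<noteq> bot"
    using \<open>compact K\<close> unfolding compact_filter by blast
  define F' where "F' = inf F (filtercomap f (nhds x))"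
  have "F' \<noteq> bot"
  proof
    assume "F' = bot"
    then have "eventually (\<lambda>_. False) F'" by simp
    then obtain P Q where P: "eventually P F" and Q: "eventually Q (nhds x)"
      and PQ: "\<And>n. P n \<Longrightarrow> Q (f n) \<Longrightarrow> False"
      unfolding F'_def eventually_inf eventually_filtercomap by blast
    have "eventually (\<lambda>y. \<not> Q y) (filtermap f F)"
      unfolding eventually_filtermap by (rule eventually_mono[OF P]) (use PQ in blast)
    with Q have "eventually (\<lambda>_. False) (inf (nhds x) (filtermap f F))"
      unfolding eventually_inf by blast
    with cluster show False by (simp add: eventually_False)
  qed
  moreover have "(f \<longlongrightarrow> x) F'"
    unfolding F'_def by (rule filterlim_mono[OF filterlim_filtercomap order_refl inf_le2])
  ultimately show ?thesis
    using that[of x F'] x by (simp add: F'_def)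
qed

lemma pointwise_limit_along_finer_filter:
  fixes f :: "nat \<Rightarrow> 'i \<Rightarrow> 'a::topological_space"
  assumes "compact X" and "\<And>n i. f n i \<in> X"
  obtains F g where "F \<le> sequentially" "F \<noteq> bot" "\<forall>i. g i \<in> X"
    "\<forall>i. ((\<lambda>n. f n i) \<longlongrightarrow> g i) F"
proof -
  have "compactin (product_topology (\<lambda>_. euclidean) UNIV) (PiE UNIV (\<lambda>_::'i. X))"
    using assms(1) by (simp add: compactin_PiE)
  then have "compact (PiE UNIV (\<lambda>_::'i. X))"
    by (simp add: euclidean_product_topology)
  moreover have "f n \<in> PiE UNIV (\<lambda>_. X)" for n
    using assms(2) by auto
  ultimately obtain g F where g: "g \<in> PiE UNIV (\<lambda>_. X)"
    and F: "F \<le> sequentially" "F \<noteq> bot" and lim: "(f \<longlongrightarrow> g) F"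
    using compact_convergent_along_finer_filter[OF _ sequentially_bot] by metis
  have "((\<lambda>n. f n i) \<longlongrightarrow> g i) F" for i
    using continuous_on_tendsto_compose[OF continuous_on_product_coordinates lim] by simp
  moreover have "g i \<in> X" for i
    using g by auto
  ultimately show ?thesis
    using that[OF F] by blast
qed

text \<open>
  Each property of the limit reply is a limit of a metric inequality for \<open>G n\<close>: the Lipschitz bound,
  the distance between replies to men who agree up to \<open>t\<close>, and, since lion and man meet at time
  \<open>c n\<close>, the bound \<open>2 * \<bar>c n - t\<bar>\<close> on their distance at time \<open>t\<close>.
\<close>

lemma lion_wins_if_vanishing_lookahead:
  fixes X :: "'a::metric_space set"
  assumes "compact X" and "x0 \<in> X"
    and G: "\<And>n. G n \<in> paths X T y0 \<rightarrow> paths X T x0"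
    and catch: "\<And>n m. m \<in> paths X T y0 \<Longrightarrow> \<exists>t\<in>{0..T}. G n m t = m t"
    and look: "\<And>n m m' t s. \<lbrakk>m \<in> paths X T y0; m' \<in> paths X T y0; s \<in> {0..t}; t \<le> T;
                 agree_upto t m m'\<rbrakk> \<Longrightarrow> dist (G n m s) (G n m' s) \<le> e n"
    and "e \<longlonglongrightarrow> 0"
  shows "\<exists>G. lion_winning_strategy X T x0 y0 G"
proof -
  let ?L = "paths X T x0" and ?M = "paths X T y0"
  \<comment> \<open>All values \<open>G n m t\<close> form one point of a power of \<open>X\<close>; the value \<open>x0\<close> for meaningless indices
    \<open>(m, t)\<close> only keeps that point inside the power.\<close>
  define f where "f = (\<lambda>n (m, t). if m \<in> ?M \<and> t \<in> {0..T} then G n m t else x0)"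
  have reply: "G n m \<in> ?L" if "m \<in> ?M" for n m
    using G that by (rule funcset_mem)
  have fX: "f n i \<in> X" for n i
    using paths_in[OF reply] \<open>x0 \<in> X\<close> by (simp add: f_def split: prod.split)
  obtain F g where F: "F \<le> sequentially" "F \<noteq> bot" and gX: "\<forall>i. g i \<in> X"
    and lim: "\<forall>i. ((\<lambda>n. f n i) \<longlongrightarrow> g i) F"
    using pointwise_limit_along_finer_filter[of X f, OF \<open>compact X\<close> fX] by blast
  have lim': "((\<lambda>n. G n m t) \<longlongrightarrow> g (m, t)) F" if "m \<in> ?M" "t \<in> {0..T}" for m t
    using lim[rule_format, of "(m, t)"] that by (simp add: f_def)
  define H where "H = (\<lambda>m. restrict (\<lambda>t. g (m, t)) {0..T})"
  have H: "((\<lambda>n. G n m t) \<longlongrightarrow> H m t) F" if "m \<in> ?M" "t \<in> {0..T}" for m t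
    using lim'[OF that] that by (simp add: H_def)
  have H_path: "H m \<in> ?L" if m: "m \<in> ?M" for m
  proof -
    have "dist (H m s) (H m t) \<le> \<bar>s - t\<bar>" if "s \<in> {0..T}" "t \<in> {0..T}" for s t
    proof (rule tendsto_upperbound[OF tendsto_dist[OF H[OF m that(1)] H[OF m that(2)]] _ F(2)])
      show "\<forall>\<^sub>F n in F. dist (G n m s) (G n m t) \<le> \<bar>s - t\<bar>"
        using paths_dist_le[OF reply[OF m] that] by (intro always_eventually allI)
    qed
    moreover have "H m 0 = x0"
    proof -
      have "0 \<in> {0..T}" using catch[OF m, of 0] by auto
      from H[OF m this] have "((\<lambda>n. x0) \<longlongrightarrow> H m 0) F"
        using paths_start[OF reply[OF m]] by simp
      then show ?thesis using tendsto_unique[OF F(2) _ tendsto_const] by blast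
    qed
    moreover have "H m \<in> {0..T} \<rightarrow>\<^sub>E X" using gX by (auto simp: H_def)
    ultimately show ?thesis by (simp add: paths_def)
  qed
  have H_agree: "agree_upto t (H m) (H m')"
    if m: "m \<in> ?M" "m' \<in> ?M" and t: "t \<in> {0..T}" and agr: "agree_upto t m m'" for m m' t
    unfolding agree_upto_def
  proof
    fix s assume s: "s \<in> {0..t}"
    then have sT: "s \<in> {0..T}" using t by simp
    have "((\<lambda>n. dist (G n m s) (G n m' s)) \<longlongrightarrow> dist (H m s) (H m' s)) F"
      by (rule tendsto_dist[OF H[OF m(1) sT] H[OF m(2) sT]])
    moreover have "(e \<longlongrightarrow> 0) F" using F(1) \<open>e \<longlonglongrightarrow> 0\<close> by (rule tendsto_mono)
    ultimately have "dist (H m s) (H m' s) \<le> 0"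
      using look[OF m s _ agr] t by (intro tendsto_le[OF F(2)]) auto
    then show "H m s = H m' s" by simp
  qed
  have H_catch: "\<exists>t\<in>{0..T}. H m t = m t" if m: "m \<in> ?M" for m
  proof -
    obtain c where c: "\<And>n. c n \<in> {0..T}" "\<And>n. G n m (c n) = m (c n)"
      using catch[OF m] by metis
    \<comment> \<open>Refine the filter once more, so that the capture times converge too.\<close>
    obtain t F' where t: "t \<in> {0..T}" and F': "F' \<le> F" "F' \<noteq> bot" and c_lim: "(c \<longlongrightarrow> t) F'"
      by (rule compact_convergent_along_finer_filter[of "{0..T}" F c, OF compact_Icc F(2) c(1)])
    have "((\<lambda>n. G n m t) \<longlongrightarrow> H m t) F'"
      using H[OF m t] by (rule tendsto_mono[OF F'(1)])
    then have "((\<lambda>n. dist (G n m t) (m t)) \<longlongrightarrow> dist (H m t) (m t)) F'"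
      by (intro tendsto_intros)
    moreover have "((\<lambda>n. 2 * \<bar>c n - t\<bar>) \<longlongrightarrow> 2 * \<bar>t - t\<bar>) F'"
      by (intro tendsto_intros c_lim)
    moreover have "dist (G n m t) (m t) \<le> 2 * \<bar>c n - t\<bar>" for n
    proof -
      have "dist (G n m (c n)) (G n m t) \<le> \<bar>c n - t\<bar>"
        by (rule paths_dist_le[OF reply[OF m] c(1) t])
      moreover have "dist (m (c n)) (m t) \<le> \<bar>c n - t\<bar>"
        by (rule paths_dist_le[OF m c(1) t])
      ultimately show ?thesis
        using dist_triangle3[of "G n m t" "m t" "m (c n)"] by (simp add: c(2))
    qed
    ultimately have "dist (H m t) (m t) \<le> 2 * \<bar>t - t\<bar>"
      by (intro tendsto_le[OF F'(2)]) auto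
    then show ?thesis using t by auto
  qed
  have "lion_winning_strategy X T x0 y0 H"
    unfolding lion_winning_strategy_def lion_strategy_def no_lookahead_strategy_def
      agree_upto_def[symmetric]
    using H_path H_catch H_agree by blast
  then show ?thesis by blast
qed

text \<open>This bounds what a lion gains by lookahead: at any time the start \<open>r\<close> of the current step is at
  most \<open>d\<close> ago, and since then both replies have moved by at most \<open>d\<close> from a common point.\<close>

lemma dist_reply_le_twice_step:
  assumes "p \<in> paths X T x" "q \<in> paths X T x" and "agree_upto r p q"
    and "0 \<le> r" "r \<le> s" "s \<le> r + d" "s \<le> T"
  shows "dist (p s) (q s) \<le> 2 * d"
proof -
  have "p r = q r" using assms by (simp add: agree_upto_def)
  moreover have "dist (p r) (p s) \<le> \<bar>r - s\<bar>" "dist (q r) (q s) \<le> \<bar>r - s\<bar>"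
    using assms paths_dist_le[of p X T x r s] paths_dist_le[of q X T x r s] by simp_all
  ultimately show ?thesis
    using dist_triangle3[of "p s" "q s" "p r"] assms by simp
qed

theorem theorem5:
  fixes X :: "'a::metric_space set" and x0 y0 :: 'a and T :: real
  assumes "compact X" and "x0 \<in> X" and "y0 \<in> X" and "x0 \<noteq> y0" and "T > 0"
  shows "(\<exists>G. lion_winning_strategy X T x0 y0 G) \<or> (\<exists>F. man_winning_strategy X T x0 y0 F)"
proof -
  let ?L = "paths X T x0" and ?M = "paths X T y0"
  let ?l0 = "restrict (\<lambda>_. x0) {0..T}" and ?m0 = "restrict (\<lambda>_. y0) {0..T}"
  have l0: "?l0 \<in> ?L" and m0: "?m0 \<in> ?M"
    using assms by (auto intro: const_path_in_paths)
  \<comment> \<open>\<open>d n\<close> is the step length of the grid with \<open>Suc n\<close> steps; the shift avoids a grid with none.\<close>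
  define d where "d n = T / real (Suc n)" for n
  define h where "h n k = real k * d n" for n k
  have "d n > 0" for n using \<open>T > 0\<close> by (simp add: d_def)
  have h: "mono (h n)" "h n 0 = 0" "h n (Suc n) = T" for n
    using \<open>d n > 0\<close> by (auto simp: h_def mono_def mult_right_mono) (simp add: d_def)
  show ?thesis
  proof (cases "\<forall>n. capture_from ?L ?M T (h n) (Suc n) 0 ?l0 ?m0")
    case False
    then show ?thesis
      using man_wins_if_discrete_escape[OF h l0 m0] by blast
  next
    case True
    let ?reply = "\<lambda>n G. (\<forall>m\<in>?M. \<exists>t\<in>{0..T}. G m t = m t) \<and>
      (\<forall>k\<le>Suc n. \<forall>m\<in>?M. \<forall>m'\<in>?M. agree_upto (h n k) m m' \<longrightarrow> agree_upto (h n k) (G m) (G m'))"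
    have "\<exists>G. G \<in> ?M \<rightarrow> ?L \<and> ?reply n G" for n
      by (rule lion_reply_if_discrete_capture[OF h l0 m0 True[rule_format], unfolded Bex_def[of "_ \<rightarrow> _"]])
    then have "\<exists>G. \<forall>n. G n \<in> ?M \<rightarrow> ?L \<and> ?reply n (G n)"
      by (intro choice allI)
    then obtain G where all: "\<forall>n. G n \<in> ?M \<rightarrow> ?L \<and> ?reply n (G n)" by (rule exE)
    have G: "G n \<in> ?M \<rightarrow> ?L" and catch: "m \<in> ?M \<Longrightarrow> \<exists>t\<in>{0..T}. G n m t = m t"
      and causal: "\<lbrakk>k \<le> Suc n; m \<in> ?M; m' \<in> ?M; agree_upto (h n k) m m'\<rbrakk>
                     \<Longrightarrow> agree_upto (h n k) (G n m) (G n m')" for n k m m'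
      using all[rule_format, of n] by blast+
    have look: "dist (G n m s) (G n m' s) \<le> 2 * d n"
      if m: "m \<in> ?M" "m' \<in> ?M" and s: "s \<in> {0..t}" "t \<le> T" and agr: "agree_upto t m m'" for n m m' t s
    proof -
      \<comment> \<open>\<open>h n k\<close> is the last grid time not after \<open>s\<close>.\<close>
      define k where "k = nat \<lfloor>s / d n\<rfloor>"
      have "0 \<le> s / d n" using s \<open>d n > 0\<close> by simp
      then have "real k \<le> s / d n" "s / d n \<le> real k + 1"
        unfolding k_def by linarith+
      then have k: "h n k \<le> s" "s \<le> h n k + d n"
        using \<open>d n > 0\<close> by (auto simp: h_def field_simps)
      have "h n k \<le> h n (Suc n)" using k s h(3)[of n] by simp
      then have "k \<le> Suc n" using \<open>d n > 0\<close> by (simp add: h_def)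
      moreover have "agree_upto (h n k) m m'"
        using agr k s by (auto intro: agree_upto_mono)
      ultimately have "agree_upto (h n k) (G n m) (G n m')"
        using causal m by blast
      moreover have "G n m \<in> ?L" "G n m' \<in> ?L" using G m by blast+
      moreover have "0 \<le> h n k" using \<open>d n > 0\<close> by (simp add: h_def)
      ultimately show ?thesis
        using k s by (intro dist_reply_le_twice_step[where r = "h n k" and T = T]) auto
    qed
    have "(\<lambda>n. 2 * d n) \<longlonglongrightarrow> 0"
      unfolding d_def using tendsto_mult_right_zero[OF lim_const_over_n[THEN LIMSEQ_Suc, of T]] by simp
    then have "\<exists>G. lion_winning_strategy X T x0 y0 G"
      using G catch look
      by (intro lion_wins_if_vanishing_lookahead[OF \<open>compact X\<close> \<open>x0 \<in> X\<close>,
            where G = G and e = "\<lambda>n. 2 * d n"])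
    then show ?thesis ..
  qed
qed

end
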